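(* Let $X$ and $Y$ be non-trivial complex Banach spaces. Suppose that $(R(t))_{t>0}\subseteq L(X,Y)$ is a strongly continuous operator family and $\int_0^\infty\|R(s)\|_{L(X,Y)}\,ds<\infty$. If $f\in Q\text{-}AAP([0,\infty):X)$, then the function $F:[0,\infty)\to Y$ defined by $F(t):=\int_0^tR(t-s)f(s)\,ds$, $t\ge0$, belongs to $Q\text{-}AAP([0,\infty):Y)$.
   Context: $L(X,Y)$ is the space of continuous linear mappings from $X$ into $Y$. For $I=[0,\infty)$ and a Banach space $Z$, $Q\text{-}AAP(I:Z)$ (quasi-asymptotically almost periodic functions) is the set of bounded continuous $f:I\to Z$ such that for each $\epsilon>0$ there exists a finite number $L(\epsilon)>0$ such that any interval $I'\subseteq I$ of length $L(\epsilon)$ contains at least one number $\tau\in I'$ for which there exists a finite number $M(\epsilon,\tau)>0$ with $\|f(t+\tau)-f(t)\|\le\epsilon$ for all $t\in I$ with $|t|\ge M(\epsilon,\tau)$. *)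

theory Defs
  imports "HOL-Analysis.Analysis"
begin

text \<open>
  The distribution only provides real Banach spaces. A complex one is a real one with a
  compatible complex scalar multiplication; the real structure is the restriction of the
  complex one, so norm, topology and integrals are those of the library.
\<close>

class complex_banach = banach +
  fixes scaleC :: "complex \<Rightarrow> 'a \<Rightarrow> 'a"  (infixr \<open>*\<^sub>C\<close> 75)
  assumes scaleC_add_right: "c *\<^sub>C (x + y) = c *\<^sub>C x + c *\<^sub>C y"
    and scaleC_add_left: "(c + d) *\<^sub>C x = c *\<^sub>C x + d *\<^sub>C x"
    and scaleC_scaleC: "c *\<^sub>C (d *\<^sub>C x) = (c * d) *\<^sub>C x"
    and scaleC_of_real: "complex_of_real r *\<^sub>C x = r *\<^sub>R x"
    and norm_scaleC: "norm (c *\<^sub>C x) = cmod c * norm x"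

instantiation complex :: complex_banach
begin

definition scaleC_complex :: "complex \<Rightarrow> complex \<Rightarrow> complex"
  where "scaleC_complex c x = c * x"

instance
  by standard
    (simp_all add: scaleC_complex_def algebra_simps norm_mult scaleR_conv_of_real)

end

text \<open>
  The space $L(X,Y)$, as a set of real-linear bounded operators: those that are also
  complex-homogeneous. The norm of \<^typ>\<open>'a \<Rightarrow>\<^sub>L 'b\<close> is the operator norm.
\<close>

definition complex_operators :: "('a::complex_banach \<Rightarrow>\<^sub>L 'b::complex_banach) set"
  where "complex_operators =
    {T. \<forall>c x. blinfun_apply T (c *\<^sub>C x) = c *\<^sub>C blinfun_apply T x}"

definition strongly_continuous_family :: 
    "(real \<Rightarrow> 'a::real_normed_vector \<Rightarrow>\<^sub>L 'b::real_normed_vector) \<Rightarrow> bool"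
  where "strongly_continuous_family R \<longleftrightarrow>
    (\<forall>x. continuous_on {0<..} (\<lambda>t. blinfun_apply (R t) x))"

text \<open>
  $Q$-$AAP([0,\infty):Z)$. A function on $[0,\infty)$ is represented by a function on the reals
  whose values at negative arguments are irrelevant. The set \<open>J\<close> ranges over all intervals of
  length \<open>L\<close> inside $[0,\infty)$: open, closed and half-open ones, with left endpoint \<open>a\<close>.
\<close>

definition QAAP :: "(real \<Rightarrow> 'z::real_normed_vector) set"
  where "QAAP = {f. continuous_on {0..} f \<and> bounded (f ` {0..}) \<and>
    (\<forall>\<epsilon>>0. \<exists>L>0. \<forall>a J.
      {a<..<a + L} \<subseteq> J \<and> J \<subseteq> {a..a + L} \<and> J \<subseteq> {0..} \<longrightarrow>
      (\<exists>\<tau>\<in>J. \<exists>M>0. \<forall>t\<ge>0. \<bar>t\<bar> \<ge> M \<longrightarrow> norm (f (t + \<tau>) - f t) \<le> \<epsilon>))}"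

end

theory Submission
  imports Defs
begin

text \<open>
  After the substitution \<open>s \<mapsto> t - s\<close>, the convolution is the integral over \<open>[0,t]\<close> of
  \<open>R(s) f(t - s)\<close>. For \<open>A\<close> fixed and \<open>t \<ge> A\<close>,
  the difference \<open>F(t + \<tau>) - F(t)\<close> is the integral over \<open>[0,A]\<close> of
  \<open>R(s)(f(t + \<tau> - s) - f(t - s))\<close> plus two integrals over parts of \<open>[A,\<infinity>)\<close>.
  The latter are small because \<open>\<parallel>R\<parallel>\<close> is integrable and \<open>f\<close> is bounded; the former is small
  as soon as \<open>t - A \<ge> M\<close>, where \<open>\<tau>\<close> and \<open>M\<close> are those of \<open>f\<close>. So \<open>F\<close> has the same
  almost periods \<open>\<tau>\<close>, and \<open>A + M\<close> replaces \<open>M\<close>.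
\<close>

section \<open>Operator families and integrability up to an endpoint\<close>

text \<open>Baire's theorem: the closed sets \<open>A n\<close> cover a complete space, so one of
  them contains a ball, and linearity carries the bound on that ball over to the operator
  norms.\<close>

lemma uniform_boundedness:
  fixes T :: "'i \<Rightarrow> 'a::banach \<Rightarrow>\<^sub>L 'b::real_normed_vector"
  assumes bdd: "\<And>x. bounded ((\<lambda>i. blinfun_apply (T i) x) ` I)"
  shows "bounded (T ` I)"
proof -
  define A where "A n = {x. \<forall>i\<in>I. norm (blinfun_apply (T i) x) \<le> real n}" for n :: nat
  have "closed (A n)" for n
  proof -
    have "A n = (\<Inter>i\<in>I. {x. norm (blinfun_apply (T i) x) \<le> real n})"
      by (auto simp: A_def)
    then show ?thesis
      by (auto intro!: closed_INT closed_Collect_le continuous_intros)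
  qed
  moreover have "(\<Union>n. A n) = UNIV"
  proof -
    have "\<exists>n. x \<in> A n" for x
    proof -
      obtain K where K: "\<And>i. i \<in> I \<Longrightarrow> norm (blinfun_apply (T i) x) \<le> K"
        using bdd[of x] by (auto simp: bounded_iff)
      obtain n where "K \<le> real n" using real_arch_simple by blast
      then have "x \<in> A n" using K by (auto simp: A_def intro: order.trans)
      then show ?thesis ..
    qed
    then show ?thesis by auto
  qed
  ultimately obtain n where "interior (A n) \<noteq> {}"
    using Met_TC.metric_Baire_category_alt[of "range A"] by (force simp: complete_UNIV)
  then obtain x0 e where e: "e > 0" "cball x0 e \<subseteq> A n"
    by (meson ex_in_conv mem_interior_cball)
  have "norm (T i) \<le> 2 * real n / e" if "i \<in> I" for i
  proof (rule norm_blinfun_bound)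
    fix z
    show "norm (blinfun_apply (T i) z) \<le> 2 * real n / e * norm z"
    proof (cases "z = 0")
      case False
      \<comment> \<open>\<open>y\<close> lies at distance \<open>e\<close> from \<open>x0\<close> in
        the direction of \<open>z\<close>; subtracting the values at these two points of the ball
        produces the factor 2.\<close>
      define y where "y = x0 + (e / norm z) *\<^sub>R z"
      have "y \<in> cball x0 e" "x0 \<in> cball x0 e"
        using False e by (auto simp: y_def dist_norm)
      then have y: "norm (blinfun_apply (T i) y) \<le> n" "norm (blinfun_apply (T i) x0) \<le> n"
        using subsetD[OF e(2)] that unfolding A_def by blast+
      have "(e / norm z) *\<^sub>R blinfun_apply (T i) z = blinfun_apply (T i) y - blinfun_apply (T i) x0"
        by (simp add: y_def blinfun.add_right blinfun.scaleR_right)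
      then have "norm ((e / norm z) *\<^sub>R blinfun_apply (T i) z) \<le> 2 * real n"
        using y norm_triangle_ineq4[of "blinfun_apply (T i) y" "blinfun_apply (T i) x0"] by simp
      then show ?thesis
        using e False by (simp add: field_simps)
    qed simp
  qed (use e in auto)
  then show ?thesis by (auto simp: bounded_iff)
qed

text \<open>Joint continuity needs local boundedness of \<open>T\<close>, which uniform boundedness supplies.\<close>

lemma continuous_on_blinfun_apply_strong:
  fixes T :: "'s::metric_space \<Rightarrow> 'a::banach \<Rightarrow>\<^sub>L 'b::real_normed_vector"
  assumes T: "\<And>x. continuous_on S (\<lambda>s. blinfun_apply (T s) x)"
    and h: "continuous_on S h"
  shows "continuous_on S (\<lambda>s. blinfun_apply (T s) (h s))"
  unfolding continuous_on_sequentially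
proof (intro allI ballI impI, elim conjE)
  fix \<sigma> s assume s: "s \<in> S" and \<sigma>: "\<forall>n. \<sigma> n \<in> S" "\<sigma> \<longlonglongrightarrow> s"
  have lim: "(\<lambda>n. blinfun_apply (T (\<sigma> n)) x) \<longlonglongrightarrow> blinfun_apply (T s) x" for x
    using T[of x] s \<sigma> by (auto simp: continuous_on_sequentially o_def)
  \<comment> \<open>Convergent sequences are bounded, so the operators along \<open>\<sigma>\<close>
    are pointwise bounded.\<close>
  have "bounded (range (\<lambda>n. T (\<sigma> n)))"
    by (rule uniform_boundedness) (use lim in \<open>blast intro: convergent_imp_bounded\<close>)
  then obtain K where K: "\<And>n. norm (T (\<sigma> n)) \<le> K"
    by (auto simp: bounded_iff)
  have "(\<lambda>n. h (\<sigma> n)) \<longlonglongrightarrow> h s"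
    using h s \<sigma> by (auto simp: continuous_on_sequentially o_def)
  then have "(\<lambda>n. K * norm (h (\<sigma> n) - h s)) \<longlonglongrightarrow> 0"
    by (intro tendsto_mult_right_zero tendsto_norm_zero) (simp add: LIM_zero)
  then have "(\<lambda>n. blinfun_apply (T (\<sigma> n)) (h (\<sigma> n) - h s)) \<longlonglongrightarrow> 0"
    by (rule Lim_null_comparison[rotated])
       (intro always_eventually allI order.trans[OF norm_blinfun] mult_right_mono K norm_ge_zero)
  \<comment> \<open>\<open>T (\<sigma> n) (h (\<sigma> n))\<close> is this null sequence plus
    \<open>T (\<sigma> n) (h s)\<close>.\<close>
  from tendsto_add[OF this lim[of "h s"]]
  show "((\<lambda>s. blinfun_apply (T s) (h s)) \<circ> \<sigma>) \<longlonglongrightarrow> blinfun_apply (T s) (h s)"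
    by (simp add: o_def blinfun.diff_right)
qed

text \<open>Bochner integrability and dominated convergence are not available for non-separable spaces.
  The primitive of \<open>g\<close> on the half-open interval is uniformly continuous, hence extends to
  the closed one, and the fundamental theorem of calculus does not look at the endpoint.\<close>

lemma integrable_on_dominated_left:
  fixes g :: "real \<Rightarrow> 'b::banach"
  assumes g: "continuous_on {a<..b} g" and h: "h integrable_on {a..b}"
    and le: "\<And>x. x \<in> {a<..b} \<Longrightarrow> norm (g x) \<le> h x"
  shows "g integrable_on {a..b}"
proof (cases "a < b")
  case True
  \<comment> \<open>Integrating from \<open>x\<close> to the right end stays away from
    \<open>a\<close>, near which \<open>g\<close> need not be bounded.\<close>
  define G where "G x = integral {x..b} g" for x
  define H where "H x = integral {a..x} h" for x
  have gi: "g integrable_on {x..y}" if "a < x" "y \<le> b" for x y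
    by (rule integrable_continuous_real) (use that in \<open>auto intro: continuous_on_subset[OF g]\<close>)
  have hi: "h integrable_on {x..y}" if "a \<le> x" "y \<le> b" for x y
    by (rule integrable_on_subinterval[OF h]) (use that in auto)
  \<comment> \<open>Domination bounds the increments of \<open>G\<close> by those of
    \<open>H\<close>, so \<open>G\<close> inherits uniform continuity up to
    \<open>a\<close>.\<close>
  have GH1: "norm (G x - G y) \<le> H y - H x" if "a < x" "x \<le> y" "y \<le> b" for x y
  proof -
    have "G x - G y = integral {x..y} g"
      using Henstock_Kurzweil_Integration.integral_combine[OF that(2,3) gi[of x b]] that by (simp add: G_def algebra_simps)
    moreover have "H y - H x = integral {x..y} h"
      using Henstock_Kurzweil_Integration.integral_combine[OF _ that(2) hi[of a y]] that by (simp add: H_def algebra_simps)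
    moreover have "norm (integral {x..y} g) \<le> integral {x..y} h"
      by (rule integral_norm_bound_integral) (use that gi hi le in auto)
    ultimately show ?thesis by simp
  qed
  have GH: "dist (G x) (G y) \<le> dist (H x) (H y)" if "x \<in> {a<..b}" "y \<in> {a<..b}" for x y
    using GH1[of x y] GH1[of y x] that
    by (cases "x \<le> y") (auto simp: dist_norm norm_minus_commute)
  have "uniformly_continuous_on {a..b} H"
    unfolding H_def by (intro compact_uniformly_continuous indefinite_integral_continuous_1 h) simp
  then have "uniformly_continuous_on {a<..b} G"
    unfolding uniformly_continuous_on_def
  proof (intro allI impI)
    fix e :: real
    assume "\<forall>e>0. \<exists>d>0. \<forall>x\<in>{a..b}. \<forall>x'\<in>{a..b}. dist x' x < d \<longrightarrow> dist (H x') (H x) < e" "e > 0"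
    then obtain d where d: "d > 0" "\<forall>x\<in>{a..b}. \<forall>x'\<in>{a..b}. dist x' x < d \<longrightarrow> dist (H x') (H x) < e"
      by blast
    show "\<exists>d>0. \<forall>x\<in>{a<..b}. \<forall>x'\<in>{a<..b}. dist x' x < d \<longrightarrow> dist (G x') (G x) < e"
      by (intro exI[of _ d] conjI ballI impI d(1) le_less_trans[OF GH] d(2)[rule_format]) auto
  qed
  then obtain E where "uniformly_continuous_on (closure {a<..b}) E" "\<And>x. x \<in> {a<..b} \<Longrightarrow> G x = E x"
    using uniformly_continuous_on_extension_on_closure by metis
  then have E: "continuous_on {a..b} E" "\<And>x. x \<in> {a<..b} \<Longrightarrow> G x = E x"
    using True by (auto simp: uniformly_continuous_imp_continuous)
  have "(E has_vector_derivative - g x) (at x)" if x: "x \<in> {a<..<b}" for x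
  proof -
    \<comment> \<open>The midpoint keeps \<open>{c..b}\<close> inside the region of continuity, with
      \<open>x\<close> in its interior.\<close>
    define c where "c = (a + x) / 2"
    have c: "a < c" "c < x" using x by (auto simp: c_def)
    have "((\<lambda>u. integral {u..b} g) has_vector_derivative - g x) (at x within {c..b})"
      by (rule integral_has_vector_derivative')
         (use x c in \<open>auto intro: continuous_on_subset[OF g]\<close>)
    then have "(G has_vector_derivative - g x) (at x)"
      using x c at_within_Icc_at[of c x b] by (simp add: G_def[abs_def])
    then show ?thesis
      by (rule has_vector_derivative_transform_within_open[where S = "{a<..<b}"]) (use x E in auto)
  qed
  then have "((\<lambda>x. - g x) has_integral (E b - E a)) {a..b}"
    using E True by (intro fundamental_theorem_of_calculus_interior) auto
  then show ?thesis
    using integrable_neg_iff by blast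
next
  case False
  then show ?thesis
    using integrable_on_refl[of g b] by (cases "a = b") auto
qed

section \<open>Integrability of the operator norm\<close>

text \<open>Strong continuity need not make \<open>norm (R s)\<close> continuous in
  \<open>s\<close>, but it is a supremum of continuous functions, hence lower semicontinuous and
  Borel measurable.\<close>

lemma norm_integrable_on_strongly_continuous:
  fixes R :: "real \<Rightarrow> 'a::real_normed_vector \<Rightarrow>\<^sub>L 'b::real_normed_vector"
  assumes R: "strongly_continuous_family R"
    and fin: "(\<integral>\<^sup>+ s\<in>{0<..}. ennreal (norm (R s)) \<partial>lborel) < \<infinity>"
  shows "(\<lambda>s. norm (R s)) integrable_on {0..}"
proof -
  \<comment> \<open>Strong continuity says nothing about \<open>R\<close> at non-positive arguments,
    so these are masked by 0.\<close>
  define r where "r s = (if s \<in> {0<..} then norm (R s) else 0)" for s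
  have "r \<in> borel_measurable borel"
    unfolding borel_measurable_iff_greater
  proof
    fix a :: real
    show "{w \<in> space borel. a < r w} \<in> sets borel"
    proof (cases "a < 0")
      case True
      then have "{w \<in> space borel. a < r w} = UNIV"
        by (auto simp: r_def intro: less_le_trans)
      then show ?thesis by simp
    next
      case False
      \<comment> \<open>For \<open>a \<ge> 0\<close>, a bound by \<open>a * norm x\<close> at every
        \<open>x\<close> would bound the operator norm by \<open>a\<close>. The existential form
        makes the superlevel set a union of open sets.\<close>
      have "a < norm (R s) \<longleftrightarrow> (\<exists>x. a * norm x < norm (blinfun_apply (R s) x))" for s
        using norm_blinfun_bound[of a "R s"] False
        by (meson linorder_not_le mult_right_mono norm_blinfun norm_ge_zero order.trans)
      then have "{w \<in> space borel. a < r w} =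
          (\<Union>x. {s \<in> {0<..}. a * norm x < norm (blinfun_apply (R s) x)})"
        using False by (auto simp: r_def split: if_splits)
      moreover have "open {s \<in> {0<..}. a * norm x < norm (blinfun_apply (R s) x)}" for x
      proof -
        have "continuous_on {0<..} (\<lambda>s. norm (blinfun_apply (R s) x))"
          using R by (auto simp: strongly_continuous_family_def intro: continuous_intros)
        from continuous_on_open_vimage[THEN iffD1, rule_format, OF _ this, of "{a * norm x<..}"]
        show ?thesis by (simp add: vimage_def Int_def conj_commute)
      qed
      ultimately show ?thesis by (auto intro!: borel_open)
    qed
  qed
  moreover have "ennreal (norm (r s)) = ennreal (norm (R s)) * indicator {0<..} s" for s
    by (simp add: r_def)
  ultimately have "integrable lborel r"
    using fin by (intro integrableI_bounded) auto
  then have "(\<lambda>s. norm (R s)) integrable_on {0<..}"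
    using integrable_on_lborel[of r] integrable_restrict_UNIV
    unfolding r_def by blast
  \<comment> \<open>Passing to \<open>{0..}\<close> adds a single point.\<close>
  then show ?thesis
    by (rule integrable_spike_set)
       (rule negligible_subset[OF negligible_sing[of 0]], force)+
qed

section \<open>Integrals of the family applied to a continuous function\<close>

context
  fixes R :: "real \<Rightarrow> 'a::banach \<Rightarrow>\<^sub>L 'b::banach"
  assumes R: "strongly_continuous_family R"
    and r: "(\<lambda>s. norm (R s)) integrable_on {0..}"
begin

lemma norm_integrable_on_Icc: "0 \<le> c \<Longrightarrow> (\<lambda>s. norm (R s)) integrable_on {c..d}"
  by (rule integrable_on_subinterval[OF r]) auto

lemma integral_norm_le: "0 \<le> c \<Longrightarrow> integral {c..d} (\<lambda>s. norm (R s)) \<le> integral {0..} (\<lambda>s. norm (R s))"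
  by (rule integral_subset_le) (auto simp: norm_integrable_on_Icc r)

text \<open>The primitive \<open>H\<close> is bounded above; once \<open>H A\<close> is within
  \<open>e\<close> of its supremum, no later increment exceeds \<open>e\<close>. This supplies the
  cut point for the convolution.\<close>

lemma integral_norm_tail:
  assumes "e > 0"
  obtains A where "A \<ge> 0" "\<And>x. integral {A..x} (\<lambda>s. norm (R s)) \<le> e"
proof -
  define H where "H x = integral {0..x} (\<lambda>s. norm (R s))" for x
  have bdd: "bdd_above (H ` {0..})"
    using integral_norm_le[of 0] by (auto simp: H_def bdd_above_def)
  have "Sup (H ` {0..}) - e < Sup (H ` {0..})" using assms by simp
  then obtain A where A: "A \<ge> 0" "Sup (H ` {0..}) - e < H A"
    using less_cSup_iff[OF _ bdd] by auto
  have "integral {A..x} (\<lambda>s. norm (R s)) \<le> e" for x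
  proof (cases "A \<le> x")
    case True
    have "H A + integral {A..x} (\<lambda>s. norm (R s)) = H x"
      unfolding H_def using A True by (intro Henstock_Kurzweil_Integration.integral_combine norm_integrable_on_Icc) auto
    moreover have "H x \<le> Sup (H ` {0..})"
      using A True by (intro cSUP_upper bdd) auto
    ultimately show ?thesis using A by linarith
  qed (use assms in simp)
  with A that show ?thesis by blast
qed

text \<open>On the compact interval \<open>h\<close> is bounded by some \<open>K\<close>, so
  \<open>K\<close> times the operator norm dominates. The left endpoint is left out because
  \<open>c\<close> may be 0, where \<open>R\<close> need not be continuous.\<close>

lemma integrable_on_family_apply:
  assumes "0 \<le> c" "continuous_on {c..d} h"
  shows "(\<lambda>s. blinfun_apply (R s) (h s)) integrable_on {c..d}"
proof -
  have "compact (h ` {c..d})"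
    using assms by (intro compact_continuous_image) auto
  then obtain K where K: "\<And>s. s \<in> {c..d} \<Longrightarrow> norm (h s) \<le> K"
    by (metis bounded_iff compact_imp_bounded image_eqI)
  show ?thesis
  proof (rule integrable_on_dominated_left)
    show "continuous_on {c<..d} (\<lambda>s. blinfun_apply (R s) (h s))"
    proof (rule continuous_on_blinfun_apply_strong)
      show "continuous_on {c<..d} h"
        by (rule continuous_on_subset[OF assms(2)]) auto
      show "continuous_on {c<..d} (\<lambda>s. blinfun_apply (R s) x)" for x
        by (rule continuous_on_subset[of "{0<..}"])
           (use R assms in \<open>auto simp: strongly_continuous_family_def\<close>)
    qed
    show "(\<lambda>s. norm (R s) * K) integrable_on {c..d}"
      by (intro integrable_on_mult_left norm_integrable_on_Icc assms)
    show "norm (blinfun_apply (R s) (h s)) \<le> norm (R s) * K" if "s \<in> {c<..d}" for s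
      by (rule order.trans[OF norm_blinfun mult_left_mono]) (use that K in auto)
  qed
qed

lemma norm_integral_family_apply_le:
  assumes "0 \<le> c" "continuous_on {c..d} h" "\<And>s. s \<in> {c..d} \<Longrightarrow> norm (h s) \<le> K"
  shows "norm (integral {c..d} (\<lambda>s. blinfun_apply (R s) (h s))) \<le> K * integral {c..d} (\<lambda>s. norm (R s))"
proof -
  have "norm (integral {c..d} (\<lambda>s. blinfun_apply (R s) (h s))) \<le> integral {c..d} (\<lambda>s. norm (R s) * K)"
  proof (rule integral_norm_bound_integral)
    show "norm (blinfun_apply (R s) (h s)) \<le> norm (R s) * K" if "s \<in> {c..d}" for s
      by (rule order.trans[OF norm_blinfun mult_left_mono]) (use that assms in auto)
  qed (use assms in \<open>auto intro!: integrable_on_family_apply integrable_on_mult_left norm_integrable_on_Icc\<close>)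
  then show ?thesis by (simp add: mult.commute)
qed

section \<open>The convolution: bounds and continuity\<close>

context
  fixes f :: "real \<Rightarrow> 'a" and B :: real
  assumes f: "continuous_on {0..} f"
    and B: "\<And>t. t \<ge> 0 \<Longrightarrow> norm (f t) \<le> B"
begin

text \<open>In this substituted form the operator \<open>R s\<close> does not depend on
  \<open>t\<close>, so values at two times are compared through \<open>f\<close> alone.\<close>

definition convolution :: "real \<Rightarrow> 'b"
  where "convolution t = integral {0..t} (\<lambda>s. blinfun_apply (R s) (f (t - s)))"

lemma continuous_on_reflected: "0 \<le> c \<Longrightarrow> d \<le> t \<Longrightarrow> continuous_on {c..d} (\<lambda>s. f (t - s))"
  by (rule continuous_on_compose2[OF f]) (auto intro!: continuous_intros)

lemma has_integral_convolution:
  assumes "t \<ge> 0"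
  shows "((\<lambda>s. blinfun_apply (R (t - s)) (f s)) has_integral convolution t) {0..t}"
proof -
  have "((\<lambda>s. blinfun_apply (R s) (f (t - s))) has_integral convolution t) {0..t}"
    unfolding convolution_def
    by (intro integrable_integral integrable_on_family_apply continuous_on_reflected) auto
  \<comment> \<open>The shift by \<open>t\<close> moves the interval to \<open>{-t..0}\<close>; the
    reflection then brings it back to \<open>{0..t}\<close>.\<close>
  from has_integral_shift_real_ivl[OF this, of t]
  have "((\<lambda>s. blinfun_apply (R (t - - s)) (f (- s))) has_integral convolution t) {- t..- 0}"
    by (simp add: add.commute)
  then show ?thesis
    using has_integral_reflect_real[of "\<lambda>s. blinfun_apply (R (t - s)) (f s)" "convolution t" t 0] by blast
qed

lemma convolution_bound: "t \<ge> 0 \<Longrightarrow> norm (convolution t) \<le> B * integral {0..} (\<lambda>s. norm (R s))"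
  unfolding convolution_def using order.trans[OF norm_ge_zero B[of 0]]
  by (intro order.trans[OF norm_integral_family_apply_le[where K = B]] mult_left_mono
      continuous_on_reflected integral_norm_le B) auto

text \<open>Both integrals are split at \<open>a\<close>: below it the values of \<open>f\<close>
  are compared, above it each is bounded separately. Continuity takes \<open>a = t\<close>; almost
  periodicity takes a fixed cut point.\<close>

lemma convolution_diff_bound:
  assumes t: "0 \<le> a" "a \<le> t" "t \<le> u"
    and \<delta>: "\<And>s. s \<in> {0..a} \<Longrightarrow> norm (f (u - s) - f (t - s)) \<le> \<delta>"
  shows "norm (convolution u - convolution t) \<le> \<delta> * integral {0..} (\<lambda>s. norm (R s)) +
    B * (integral {a..u} (\<lambda>s. norm (R s)) + integral {a..t} (\<lambda>s. norm (R s)))"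
proof -
  define P where "P = (\<lambda>w s. blinfun_apply (R s) (f (w - s)))"
  have split: "convolution w = integral {0..a} (P w) + integral {a..w} (P w)" if "a \<le> w" for w
    unfolding convolution_def P_def using t that
    by (intro Henstock_Kurzweil_Integration.integral_combine[symmetric] integrable_on_family_apply continuous_on_reflected) auto
  have "integral {0..a} (P u) - integral {0..a} (P t)
      = integral {0..a} (\<lambda>s. blinfun_apply (R s) (f (u - s) - f (t - s)))"
    unfolding P_def blinfun.diff_right using t
    by (intro integral_diff[symmetric] integrable_on_family_apply continuous_on_reflected) auto
  also have "norm \<dots> \<le> \<delta> * integral {0..a} (\<lambda>s. norm (R s))"
    using t \<delta> by (intro norm_integral_family_apply_le continuous_intros continuous_on_reflected) auto
  \<comment> \<open>\<open>\<delta>\<close> is non-negative because it bounds a norm at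
    \<open>s = 0\<close>.\<close>
  also have "\<dots> \<le> \<delta> * integral {0..} (\<lambda>s. norm (R s))"
    using order.trans[OF norm_ge_zero \<delta>[of 0]] t by (intro mult_left_mono integral_norm_le) auto
  finally have 1: "norm (integral {0..a} (P u) - integral {0..a} (P t))
    \<le> \<delta> * integral {0..} (\<lambda>s. norm (R s))" .
  have 2: "norm (integral {a..w} (P w)) \<le> B * integral {a..w} (\<lambda>s. norm (R s))" for w
    unfolding P_def using t by (intro norm_integral_family_apply_le continuous_on_reflected B) auto
  have "convolution u - convolution t = (integral {0..a} (P u) - integral {0..a} (P t))
      + (integral {a..u} (P u) - integral {a..t} (P t))"
    using t by (simp add: split)
  also have "norm \<dots> \<le> norm (integral {0..a} (P u) - integral {0..a} (P t))
      + (norm (integral {a..u} (P u)) + norm (integral {a..t} (P t)))"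
    by (intro norm_triangle_le add_left_mono norm_triangle_ineq4)
  also have "\<dots> \<le> \<delta> * integral {0..} (\<lambda>s. norm (R s)) +
      (B * integral {a..u} (\<lambda>s. norm (R s)) + B * integral {a..t} (\<lambda>s. norm (R s)))"
    by (intro add_mono 1 2)
  finally show ?thesis
    by (simp add: distrib_left)
qed

text \<open>On \<open>{0..T}\<close> an increment of the convolution is controlled by the modulus of
  continuity of \<open>f\<close> and an increment of the primitive \<open>H\<close> of the operator
  norm.\<close>

lemma continuous_on_convolution: "continuous_on {0..} convolution"
proof -
  have "uniformly_continuous_on {0..T} convolution" for T
    unfolding uniformly_continuous_on_def
  proof (intro allI impI)
    fix e :: real assume e: "e > 0"
    define C where "C = integral {0..} (\<lambda>s. norm (R s))"
    define H where "H x = integral {0..x} (\<lambda>s. norm (R s))" for x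
    have C0: "C \<ge> 0" unfolding C_def by (rule Henstock_Kurzweil_Integration.integral_nonneg[OF r]) auto
    have B0: "B \<ge> 0" using order.trans[OF norm_ge_zero B[of 0]] by simp
    \<comment> \<open>The final bound is \<open>\<eta> * C + B * \<eta>\<close>; the summand 1 makes
      it strictly less than \<open>e\<close> and the denominator positive.\<close>
    define \<eta> where "\<eta> = e / (C + B + 1)"
    have \<eta>: "\<eta> > 0" "\<eta> * (C + B) < e"
      using e C0 B0 by (auto simp: \<eta>_def field_simps)
    have "uniformly_continuous_on {0..T} f"
      by (intro compact_uniformly_continuous continuous_on_subset[OF f]) auto
    then obtain d1 where d1: "d1 > 0"
      "\<And>x y. x \<in> {0..T} \<Longrightarrow> y \<in> {0..T} \<Longrightarrow> dist x y < d1 \<Longrightarrow> dist (f x) (f y) < \<eta>"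
      using \<eta> unfolding uniformly_continuous_on_def by metis
    have "uniformly_continuous_on {0..T} H"
      unfolding H_def
      by (intro compact_uniformly_continuous indefinite_integral_continuous_1 norm_integrable_on_Icc) auto
    then obtain d2 where d2: "d2 > 0"
      "\<And>x y. x \<in> {0..T} \<Longrightarrow> y \<in> {0..T} \<Longrightarrow> dist x y < d2 \<Longrightarrow> dist (H x) (H y) < \<eta>"
      using \<eta> unfolding uniformly_continuous_on_def by metis
    have *: "dist (convolution u) (convolution t) < e"
      if "0 \<le> t" "t \<le> u" "u \<le> T" "dist t u < min d1 d2" for t u
    proof -
      have "norm (f (u - s) - f (t - s)) \<le> \<eta>" if "s \<in> {0..t}" for s
        using d1(2)[of "u - s" "t - s"] that \<open>t \<le> u\<close> \<open>u \<le> T\<close> \<open>dist t u < min d1 d2\<close>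
        by (simp add: dist_norm)
      \<comment> \<open>With the cut at \<open>t\<close>, the second tail is an integral over a
        single point.\<close>
      then have "norm (convolution u - convolution t)
          \<le> \<eta> * C + B * (integral {t..u} (\<lambda>s. norm (R s)) + integral {t..t} (\<lambda>s. norm (R s)))"
        unfolding C_def using that by (intro convolution_diff_bound) auto
      moreover have "H t + integral {t..u} (\<lambda>s. norm (R s)) = H u"
        unfolding H_def using that by (intro Henstock_Kurzweil_Integration.integral_combine norm_integrable_on_Icc) auto
      then have "integral {t..u} (\<lambda>s. norm (R s)) \<le> \<eta>"
        using d2(2)[of t u] that by (simp add: dist_norm)
      then have "B * integral {t..u} (\<lambda>s. norm (R s)) \<le> B * \<eta>"
        using B0 by (rule mult_left_mono)
      ultimately show ?thesis
        using \<eta> by (simp add: dist_norm algebra_simps)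
    qed
    show "\<exists>d>0. \<forall>x\<in>{0..T}. \<forall>x'\<in>{0..T}. dist x' x < d \<longrightarrow> dist (convolution x') (convolution x) < e"
    proof (intro exI[of _ "min d1 d2"] conjI ballI impI)
      fix x x' assume "x \<in> {0..T}" "x' \<in> {0..T}" "dist x' x < min d1 d2"
      then show "dist (convolution x') (convolution x) < e"
        using *[of x x'] *[of x' x] by (cases "x \<le> x'") (auto simp: dist_commute)
    qed (use d1 d2 in simp)
  qed
  then have cont: "continuous_on {0..T} convolution" for T
    by (rule uniformly_continuous_imp_continuous)
  \<comment> \<open>Continuity is local, and \<open>{0..t + 1}\<close> is a neighbourhood of
    \<open>t\<close> relative to \<open>{0..}\<close>.\<close>
  have "continuous (at t within {0..}) convolution" if "t \<ge> 0" for t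
  proof -
    have "at t within {0..} = at t within {0..t + 1}"
      by (rule at_within_nhd[of _ "{..<t + 1}"]) auto
    then show ?thesis
      using cont[of "t + 1"] that by (simp add: continuous_on_eq_continuous_within)
  qed
  then show ?thesis
    by (simp add: continuous_on_eq_continuous_within)
qed

end

end

section \<open>Quasi-asymptotic almost periodicity of the convolution\<close>

lemma convolution_QAAP:
  fixes R :: "real \<Rightarrow> 'a::banach \<Rightarrow>\<^sub>L 'b::banach"
  assumes R: "strongly_continuous_family R"
    and r: "(\<lambda>s. norm (R s)) integrable_on {0..}"
    and f: "f \<in> QAAP"
  shows "convolution R f \<in> QAAP"
proof -
  have cf: "continuous_on {0..} f"
    and ap: "\<And>\<epsilon>. \<epsilon> > 0 \<Longrightarrow> \<exists>L>0. \<forall>a J.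
      {a<..<a + L} \<subseteq> J \<and> J \<subseteq> {a..a + L} \<and> J \<subseteq> {0..} \<longrightarrow>
      (\<exists>\<tau>\<in>J. \<exists>M>0. \<forall>t\<ge>0. \<bar>t\<bar> \<ge> M \<longrightarrow> norm (f (t + \<tau>) - f t) \<le> \<epsilon>)"
    using f by (simp_all add: QAAP_def)
  have "bounded (f ` {0..})"
    using f by (simp add: QAAP_def)
  then obtain B where B: "\<And>t. t \<ge> 0 \<Longrightarrow> norm (f t) \<le> B"
    by (auto simp: bounded_iff)
  define F where "F = convolution R f"
  define C where "C = integral {0..} (\<lambda>s. norm (R s))"
  have C0: "C \<ge> 0" unfolding C_def by (rule Henstock_Kurzweil_Integration.integral_nonneg[OF r]) auto
  have B0: "B \<ge> 0" using order.trans[OF norm_ge_zero B[of 0]] by simp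
  have "\<exists>L>0. \<forall>a J. {a<..<a + L} \<subseteq> J \<and> J \<subseteq> {a..a + L} \<and> J \<subseteq> {0..} \<longrightarrow>
      (\<exists>\<tau>\<in>J. \<exists>M>0. \<forall>t\<ge>0. \<bar>t\<bar> \<ge> M \<longrightarrow> norm (F (t + \<tau>) - F t) \<le> \<epsilon>)"
    if "\<epsilon> > 0" for \<epsilon>
  proof -
    \<comment> \<open>\<open>C\<close> accounts for the integral over \<open>{0..A}\<close>, and
      \<open>2 * B\<close> for two tails of mass at most \<open>\<eta>\<close> each.\<close>
    define \<eta> where "\<eta> = \<epsilon> / (C + 2 * B + 1)"
    have \<eta>: "\<eta> > 0" "\<eta> * (C + 2 * B) \<le> \<epsilon>"
      using that C0 B0 by (auto simp: \<eta>_def field_simps)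
    obtain A where A: "A \<ge> 0" "\<And>x. integral {A..x} (\<lambda>s. norm (R s)) \<le> \<eta>"
      using integral_norm_tail[OF R r \<eta>(1)] by metis
    have shift: "norm (F (t + \<tau>) - F t) \<le> \<epsilon>"
      if \<tau>: "\<tau> \<ge> 0" "\<And>t. t \<ge> M \<Longrightarrow> norm (f (t + \<tau>) - f t) \<le> \<eta>" and t: "t \<ge> A + M" "M > 0" for \<tau> M t
    proof -
      \<comment> \<open>For \<open>s \<le> A\<close> and \<open>t \<ge> A + M\<close>, the argument
        \<open>t - s\<close> is still at least \<open>M\<close>.\<close>
      have "norm (f (t + \<tau> - s) - f (t - s)) \<le> \<eta>" if "s \<in> {0..A}" for s
        using \<tau>(2)[of "t - s"] t that by (simp add: algebra_simps)
      then have "norm (F (t + \<tau>) - F t) \<le> \<eta> * C +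
          B * (integral {A..t + \<tau>} (\<lambda>s. norm (R s)) + integral {A..t} (\<lambda>s. norm (R s)))"
        unfolding F_def C_def using A \<tau> t
        by (intro convolution_diff_bound[OF R r cf B]) auto
      also have "\<dots> \<le> \<eta> * C + B * (\<eta> + \<eta>)"
        using B0 A by (intro add_left_mono mult_left_mono add_mono) auto
      also have "\<dots> \<le> \<epsilon>" using \<eta> by (simp add: algebra_simps)
      finally show ?thesis .
    qed
    obtain L where L: "L > 0" "\<And>a J. {a<..<a + L} \<subseteq> J \<and> J \<subseteq> {a..a + L} \<and> J \<subseteq> {0..} \<Longrightarrow>
      (\<exists>\<tau>\<in>J. \<exists>M>0. \<forall>t\<ge>0. \<bar>t\<bar> \<ge> M \<longrightarrow> norm (f (t + \<tau>) - f t) \<le> \<eta>)"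
      using ap[OF \<eta>(1)] by metis
    show ?thesis
    proof (intro exI[of _ L] conjI allI impI L(1))
      fix a J assume J: "{a<..<a + L} \<subseteq> J \<and> J \<subseteq> {a..a + L} \<and> J \<subseteq> {0..}"
      then obtain \<tau> M where \<tau>: "\<tau> \<in> J" "M > 0"
        "\<And>t. t \<ge> 0 \<Longrightarrow> \<bar>t\<bar> \<ge> M \<Longrightarrow> norm (f (t + \<tau>) - f t) \<le> \<eta>"
        using L(2) by meson
      show "\<exists>\<tau>\<in>J. \<exists>M>0. \<forall>t\<ge>0. \<bar>t\<bar> \<ge> M \<longrightarrow> norm (F (t + \<tau>) - F t) \<le> \<epsilon>"
        using \<tau> J A by (intro bexI[of _ \<tau>] exI[of _ "A + M"]) (auto intro!: shift[of \<tau> M])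
    qed
  qed
  moreover have "continuous_on {0..} F"
    unfolding F_def by (rule continuous_on_convolution[OF R r cf B])
  moreover have "bounded (F ` {0..})"
    using convolution_bound[OF R r cf B] by (auto simp: F_def bounded_iff)
  ultimately show ?thesis
    by (simp add: QAAP_def F_def)
qed

text \<open>Since \<open>J\<close> lies in \<open>{0..}\<close>, every \<open>t + \<tau>\<close> is
  non-negative and values at negative arguments never enter. This transfers membership between the
  two forms of the convolution, identified for \<open>t \<ge> 0\<close>.\<close>

lemma QAAP_cong:
  assumes eq: "\<And>t. t \<ge> 0 \<Longrightarrow> f t = g t" and f: "f \<in> QAAP"
  shows "g \<in> QAAP"
proof -
  have "continuous_on {0..} g" "bounded (g ` {0..})"
    using f eq continuous_on_cong[of "{0..}" "{0..}" g f] image_cong[of "{0..}" "{0..}" g f]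
    by (auto simp: QAAP_def)
  moreover have "(\<exists>\<tau>\<in>J. \<exists>M>0. \<forall>t\<ge>0. \<bar>t\<bar> \<ge> M \<longrightarrow> norm (g (t + \<tau>) - g t) \<le> \<epsilon>) \<longleftrightarrow>
      (\<exists>\<tau>\<in>J. \<exists>M>0. \<forall>t\<ge>0. \<bar>t\<bar> \<ge> M \<longrightarrow> norm (f (t + \<tau>) - f t) \<le> \<epsilon>)" if "J \<subseteq> {0..}" for J \<epsilon>
  proof (rule bex_cong[OF refl])
    fix \<tau> assume "\<tau> \<in> J"
    then have "g (t + \<tau>) - g t = f (t + \<tau>) - f t" if "t \<ge> 0" for t
      using eq[of t] eq[of "t + \<tau>"] that \<open>J \<subseteq> {0..}\<close> by auto
    then show "(\<exists>M>0. \<forall>t\<ge>0. \<bar>t\<bar> \<ge> M \<longrightarrow> norm (g (t + \<tau>) - g t) \<le> \<epsilon>) \<longleftrightarrow>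
      (\<exists>M>0. \<forall>t\<ge>0. \<bar>t\<bar> \<ge> M \<longrightarrow> norm (f (t + \<tau>) - f t) \<le> \<epsilon>)"
      by simp
  qed
  ultimately show ?thesis
    using f by (simp add: QAAP_def cong: conj_cong)
qed

theorem proposition3p1:
  fixes R :: "real \<Rightarrow> 'a::complex_banach \<Rightarrow>\<^sub>L 'b::complex_banach"
    and f :: "real \<Rightarrow> 'a"
  assumes "\<exists>x::'a. x \<noteq> 0" and "\<exists>y::'b. y \<noteq> 0"
    and "\<And>t. t > 0 \<Longrightarrow> R t \<in> complex_operators"
    and "strongly_continuous_family R"
    and "(\<integral>\<^sup>+ s\<in>{0<..}. ennreal (norm (R s)) \<partial>lborel) < \<infinity>"
    and "f \<in> QAAP"
  shows "(\<forall>t\<ge>0. (\<lambda>s. blinfun_apply (R (t - s)) (f s)) integrable_on {0..t}) \<and>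
    (\<lambda>t. integral {0..t} (\<lambda>s. blinfun_apply (R (t - s)) (f s))) \<in> QAAP"
proof -
  note r = norm_integrable_on_strongly_continuous[OF assms(4,5)]
  have f: "continuous_on {0..} f" and "bounded (f ` {0..})"
    using assms(6) by (simp_all add: QAAP_def)
  then obtain B where "\<And>t. t \<ge> 0 \<Longrightarrow> norm (f t) \<le> B"
    by (auto simp: bounded_iff)
  \<comment> \<open>\<open>integral\<close> is 0 by default on non-integrable functions;
    \<open>has_int\<close> yields genuine integrability as well as the value.\<close>
  note has_int = has_integral_convolution[OF assms(4) r f this]
  have "(\<lambda>t. integral {0..t} (\<lambda>s. blinfun_apply (R (t - s)) (f s))) \<in> QAAP"
    by (rule QAAP_cong[OF _ convolution_QAAP[OF assms(4) r assms(6)]])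
       (use has_int in \<open>simp add: integral_unique[symmetric]\<close>)
  then show ?thesis
    using has_int by blast
qed

end
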